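(* Let $n$ be a positive integer. The random set $\mathbf{U}_n$ is exchangeable with \[ \mathbb{P}\{\#\mathbf{U}_n = m\} = \frac{1}{m!}\left(\sum_{h=0}^{n-m-1} (-1)^h \frac{1}{h!}\,\frac{n}{n-m-h} + (-1)^{n-m}\frac{1}{(n-m)!}\, n\right) \] for $0 \le m \le n$.
   Context: For a positive integer $n$, $[n] := \{1,2,\ldots,n\}$ and $\mathfrak{S}_n$ is the set of permutations of $[n]$. $\Pi_n$ denotes a random permutation uniformly distributed on $\mathfrak{S}_n$. The random set $\mathbf{U}_n \subseteq [n]$ is \[ \mathbf{U}_n := \{k \in [n] : \Pi_n(k+1 \bmod n) = \Pi_n(k)+1 \bmod n\}, \] where $j \bmod n$ denotes the unique element of $[n]$ congruent to $j$ modulo $n$ (so $n+1 \bmod n = 1$). $\#A$ denotes the cardinality of $A$, and an empty sum is $0$. A random subset $\mathbf{A}$ of $[n]$ is exchangeable if, conditional on $\#\mathbf{A} = m$ (for each $m$ having positive probability), $\mathbf{A}$ is distributed as $m$ random draws without replacement from $[n]$, i.e. it is uniformly distributed over the $m$-element subsets of $[n]$; equivalently, $\mathbb{P}\{\mathbf{A} = A\}$ depends only on $\#A$ for $A \subseteq [n]$. *)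

theory Defs
  imports "HOL-Probability.Probability" "HOL-Combinatorics.Permutations" "HOL-Number_Theory.Cong"
begin

text \<open>The residue of \<open>j\<close> modulo \<open>n\<close>, represented in \<open>{1..n}\<close> rather than \<open>{0..<n}\<close>.\<close>

definition mod1 :: "nat \<Rightarrow> nat \<Rightarrow> nat" where
  "mod1 j n = (THE i. i \<in> {1..n} \<and> [i = j] (mod n))"

lemma mod1_unique_ex:
  fixes j n :: nat
  assumes "n > 0"
  shows "\<exists>!i. i \<in> {1..n} \<and> [i = j] (mod n)"
proof (rule ex_ex1I)
  show "\<exists>i. i \<in> {1..n} \<and> [i = j] (mod n)"
  proof (cases "j mod n = 0")
    case True
    then show ?thesis using assms by (intro exI[of _ n]) (auto simp: cong_def)
  next
    case False
    then show ?thesis using assms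
      by (intro exI[of _ "j mod n"]) (auto simp: cong_def intro: less_imp_le)
  qed
next
  fix i k
  assume "i \<in> {1..n} \<and> [i = j] (mod n)" "k \<in> {1..n} \<and> [k = j] (mod n)"
  then show "i = k"
    by (cases "i = n"; cases "k = n") (auto simp: cong_def)
qed

definition succession_set :: "nat \<Rightarrow> (nat \<Rightarrow> nat) \<Rightarrow> nat set" where
  "succession_set n \<pi> = {k \<in> {1..n}. \<pi> (mod1 (k + 1) n) = mod1 (\<pi> k + 1) n}"

definition random_perm :: "nat \<Rightarrow> (nat \<Rightarrow> nat) pmf" where
  "random_perm n = pmf_of_set {\<pi>. \<pi> permutes {1..n}}"

definition random_U :: "nat \<Rightarrow> nat set pmf" where
  "random_U n = map_pmf (succession_set n) (random_perm n)"

text \<open>A random subset of \<open>{1..n}\<close>, given by its law, is exchangeable if, conditionally on having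
  \<open>m\<close> elements, it is uniform on the \<open>m\<close>-element subsets, for every \<open>m\<close> of positive probability.\<close>

definition exchangeable :: "nat \<Rightarrow> nat set pmf \<Rightarrow> bool" where
  "exchangeable n p \<longleftrightarrow>
     set_pmf p \<subseteq> Pow {1..n} \<and>
     (\<forall>m. measure_pmf.prob p {A. card A = m} > 0 \<longrightarrow>
        cond_pmf p {A. card A = m} = pmf_of_set {A. A \<subseteq> {1..n} \<and> card A = m})"

end

theory Submission
  imports Defs "HOL-Combinatorics.Multiset_Permutations"
begin

text \<open>For \<open>A \<subset> {1..n}\<close>, a permutation with \<open>A \<subseteq> U\<close> amounts to a cyclic arrangement of the \<open>n - #A\<close> blocks
  into which \<open>A\<close> ties the positions, together with one of \<open>n\<close> rotations of the values. So there are
  \<open>n (n - #A - 1)!\<close> of them, which depends only on \<open>#A\<close>. By inclusion-exclusion over the supersets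
  of \<open>A\<close>, the number of permutations with \<open>U = A\<close> also depends only on \<open>#A\<close>; the summand belonging
  to the full set \<open>{1..n}\<close> is the exceptional last term of the formula.\<close>

section \<open>Lists with a fixed head and prescribed adjacencies\<close>

text \<open>Base case of the deletion induction below: removing the fixed head leaves an arbitrary
  arrangement of the remaining elements.\<close>

lemma card_permutations_of_set_hd:
  assumes "finite S" "z \<in> S"
  shows "card {xs \<in> permutations_of_set S. hd xs = z} = fact (card S - 1)"
proof -
  have "{xs \<in> permutations_of_set S. hd xs = z} = (#) z ` permutations_of_set (S - {z})"
  proof (intro equalityI subsetI)
    fix xs assume "xs \<in> {xs \<in> permutations_of_set S. hd xs = z}"
    then have xs: "set xs = S" "distinct xs" "hd xs = z"
      by (auto dest: permutations_of_setD)
    then obtain ys where ys: "xs = z # ys"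
      using assms by (cases xs) auto
    then have "ys \<in> permutations_of_set (S - {z})"
      using xs(1,2) by (intro permutations_of_setI) (simp_all flip: xs(1))
    then show "xs \<in> (#) z ` permutations_of_set (S - {z})"
      using ys by blast
  next
    fix xs assume "xs \<in> (#) z ` permutations_of_set (S - {z})"
    then show "xs \<in> {xs \<in> permutations_of_set S. hd xs = z}"
      using assms by (force simp: permutations_of_set_def)
  qed
  then show ?thesis
    using assms by (simp add: card_image card_permutations_of_set)
qed

text \<open>If \<open>k \<in> A\<close> and \<open>s k \<notin> A\<close>, then deleting \<open>s k\<close> from the list is invertible and leaves the other
  adjacency conditions unchanged.\<close>

lemma card_permutations_of_set_adjacent:
  assumes "finite S" "A \<subseteq> S" "s ` A \<subseteq> S" "inj_on s A" "z \<in> S" "z \<notin> s ` A"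
    and acyclic: "\<And>B. B \<subseteq> A \<Longrightarrow> B \<noteq> {} \<Longrightarrow> \<exists>k\<in>B. s k \<notin> B"
  shows "card {xs \<in> permutations_of_set S. hd xs = z \<and> (\<forall>k\<in>A. \<exists>us vs. xs = us @ k # s k # vs)}
    = fact (card S - card A - 1)"
proof -
  have "finite A"
    using assms(1,2) finite_subset by blast
  then show ?thesis
    using assms
  proof (induction A arbitrary: S rule: finite_psubset_induct)
    case (psubset A)
    let ?L = "\<lambda>S A. {xs \<in> permutations_of_set S. hd xs = z \<and>
      (\<forall>k\<in>A. \<exists>us vs. xs = us @ k # s k # vs)}"
    show ?case
    proof (cases "A = {}")
      case True
      then show ?thesis
        using psubset.prems card_permutations_of_set_hd by simp
    next
      case False
      \<comment> \<open>Acyclicity, applied to \<open>A\<close> itself, provides an element whose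
        successor lies outside \<open>A\<close>.\<close>
      then obtain k where k: "k \<in> A" "s k \<notin> A"
        using psubset.prems(7) by blast
      define t where "t = s k"
      \<comment> \<open>\<open>E\<close> undoes the deletion by reinserting \<open>t\<close>
        directly after \<open>k\<close>.\<close>
      define E where "E = (\<lambda>xs. concat (map (\<lambda>x. if x = k then [k, t] else [x]) xs))"
      have E_id: "E xs = xs" if "k \<notin> set xs" for xs
        using that by (induction xs) (auto simp: E_def)
      have filter_id: "filter (\<lambda>x. x \<noteq> t) xs = xs" if "t \<notin> set xs" for xs
        using that by (induction xs) auto
      \<comment> \<open>Deleting \<open>t\<close> is harmless: \<open>z\<close> is no successor, so
        the head survives; no adjacency condition starts at \<open>t\<close>, and by injectivity of
        \<open>s\<close> only the one for \<open>k\<close> ends there.\<close>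
      have t: "t \<notin> A" "t \<in> S" "t \<noteq> z" "t \<noteq> k"
        using k psubset.prems by (auto simp: t_def)
      have st: "s j \<noteq> t" if "j \<in> A - {k}" for j
        using that k psubset.prems(4) by (auto simp: t_def inj_on_def)
      have "bij_betw (filter (\<lambda>x. x \<noteq> t)) (?L S A) (?L (S - {t}) (A - {k}))"
      proof (rule bij_betw_byWitness[where f' = E])
        show "\<forall>xs\<in>?L S A. E (filter (\<lambda>x. x \<noteq> t) xs) = xs"
        proof
          fix xs assume xs: "xs \<in> ?L S A"
          then obtain us vs where "xs = us @ k # t # vs"
            using k unfolding t_def by blast
          moreover from xs have "distinct xs"
            by (auto dest: permutations_of_setD)
          ultimately show "E (filter (\<lambda>x. x \<noteq> t) xs) = xs"
            using E_id[of us] E_id[of vs] filter_id[of us] filter_id[of vs] t by (auto simp: E_def)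
        qed
        have expand: "E ys \<in> ?L S A \<and> filter (\<lambda>x. x \<noteq> t) (E ys) = ys"
          if ys: "ys \<in> ?L (S - {t}) (A - {k})" for ys
        proof -
          from ys have set: "set ys = S - {t}" "distinct ys" "hd ys = z"
            by (auto dest: permutations_of_setD)
          then have "k \<in> set ys"
            using k t psubset.prems by auto
          then obtain us vs where split: "ys = us @ k # vs"
            by (meson split_list)
          have eq: "E ys = us @ k # t # vs"
            using split set E_id[of us] E_id[of vs] by (auto simp: E_def)
          have "hd (E ys) = z"
            using split set eq by (cases us) auto
          moreover have "E ys \<in> permutations_of_set S"
            using split set eq t by (intro permutations_of_setI) auto
          moreover have "\<exists>us vs. E ys = us @ j # s j # vs" if "j \<in> A" for j
          proof (cases "j = k")
            case True
            then show ?thesis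
              using eq unfolding t_def by blast
          next
            case False
            then obtain us' vs' where "ys = us' @ j # s j # vs'"
              using ys \<open>j \<in> A\<close> by blast
            \<comment> \<open>If \<open>s j = k\<close>, the inserted \<open>t\<close> comes after
              \<open>s j\<close>, so \<open>j\<close> and \<open>s j\<close> stay adjacent.\<close>
            then have "E ys = E us' @ j # s j # (if s j = k then [t] else []) @ E vs'"
              using False by (simp add: E_def)
            then show ?thesis
              by blast
          qed
          moreover have "filter (\<lambda>x. x \<noteq> t) (E ys) = ys"
          proof -
            have "t \<notin> set us" "t \<notin> set vs"
              using split set by auto
            then show ?thesis
              unfolding eq unfolding split using t by (simp add: filter_id)
          qed
          ultimately show ?thesis
            by blast
        qed
        then show "\<forall>ys\<in>?L (S - {t}) (A - {k}). filter (\<lambda>x. x \<noteq> t) (E ys) = ys"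
          and "E ` ?L (S - {t}) (A - {k}) \<subseteq> ?L S A"
          by blast+
        show "filter (\<lambda>x. x \<noteq> t) ` ?L S A \<subseteq> ?L (S - {t}) (A - {k})"
        proof (rule image_subsetI)
          fix xs assume xs: "xs \<in> ?L S A"
          then have set: "set xs = S" "distinct xs" "hd xs = z"
            by (auto dest: permutations_of_setD)
          have "hd (filter (\<lambda>x. x \<noteq> t) xs) = z"
            using set t by (cases xs) auto
          moreover have "filter (\<lambda>x. x \<noteq> t) xs \<in> permutations_of_set (S - {t})"
            using set by (intro permutations_of_setI) auto
          moreover have "\<exists>us vs. filter (\<lambda>x. x \<noteq> t) xs = us @ j # s j # vs"
            if j: "j \<in> A - {k}" for j
          proof -
            obtain us vs where "xs = us @ j # s j # vs"
              using xs j by blast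
            then have "filter (\<lambda>x. x \<noteq> t) xs =
                filter (\<lambda>x. x \<noteq> t) us @ j # s j # filter (\<lambda>x. x \<noteq> t) vs"
              using j t st by auto
            then show ?thesis
              by blast
          qed
          ultimately show "filter (\<lambda>x. x \<noteq> t) xs \<in> ?L (S - {t}) (A - {k})"
            by blast
        qed
      qed
      then have "card (?L S A) = card (?L (S - {t}) (A - {k}))"
        by (rule bij_betw_same_card)
      also have "\<dots> = fact (card (S - {t}) - card (A - {k}) - 1)"
      proof (rule psubset.IH)
        show "A - {k} \<subset> A"
          using k by blast
        show "A - {k} \<subseteq> S - {t}" "finite (S - {t})" "z \<in> S - {t}" "z \<notin> s ` (A - {k})"
          using psubset.prems t by auto
        show "s ` (A - {k}) \<subseteq> S - {t}"
          using psubset.prems(3) st by blast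
        show "inj_on s (A - {k})"
          using psubset.prems(4) by (rule inj_on_subset) auto
        show "\<exists>j\<in>B. s j \<notin> B" if "B \<subseteq> A - {k}" "B \<noteq> {}" for B
          using that psubset.prems(7) by blast
      qed
      \<comment> \<open>The two decrements cancel under truncated subtraction because
        \<open>A\<close> is nonempty.\<close>
      also have "card (S - {t}) - card (A - {k}) - 1 = card S - card A - 1"
      proof -
        have "card A > 0"
          using k psubset.hyps by (auto simp: card_gt_0_iff)
        then show ?thesis
          using k t psubset.prems(1) psubset.hyps by simp
      qed
      finally show ?thesis .
    qed
  qed
qed

section \<open>The cyclic successor on \<open>{1..n}\<close>\<close>

lemma mod1_in: "n > 0 \<Longrightarrow> mod1 j n \<in> {1..n}"
  and mod1_cong: "n > 0 \<Longrightarrow> [mod1 j n = j] (mod n)"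
  using theI'[OF mod1_unique_ex[of n j]] unfolding mod1_def by auto

lemma mod1_eq_iff:
  assumes "n > 0"
  shows "mod1 i n = mod1 j n \<longleftrightarrow> [i = j] (mod n)"
proof
  assume "mod1 i n = mod1 j n"
  then show "[i = j] (mod n)"
    using mod1_cong[OF assms] by (metis cong_sym cong_trans)
next
  assume "[i = j] (mod n)"
  then show "mod1 i n = mod1 j n"
    unfolding mod1_def by (metis cong_trans cong_sym)
qed

lemma mod1_id:
  assumes "i \<in> {1..n}"
  shows "mod1 i n = i"
  using assms mod1_unique_ex[of n i] mod1_in[of n i] mod1_cong[of n i] by (auto 0 3)

lemma mod1_Suc_mod1: "n > 0 \<Longrightarrow> mod1 (mod1 j n + 1) n = mod1 (Suc j) n"
  using mod1_cong[of n j] by (simp add: mod1_eq_iff cong_def) (metis mod_Suc_eq)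

lemma bij_betw_mod1_add:
  assumes "n > 0"
  shows "bij_betw (\<lambda>i. mod1 (c + i) n) {..<n} {1..n}"
proof -
  have inj: "inj_on (\<lambda>i. mod1 (c + i) n) {..<n}"
    using assms
    by (auto simp: inj_on_def mod1_eq_iff cong_add_lcancel_nat intro: cong_less_modulus_unique_nat)
  moreover have "(\<lambda>i. mod1 (c + i) n) ` {..<n} = {1..n}"
    using mod1_in[OF assms] by (intro card_subset_eq) (auto simp: card_image[OF inj])
  ultimately show ?thesis
    by (simp add: bij_betw_def)
qed

lemma inj_on_mod1_Suc: "inj_on (\<lambda>k. mod1 (k + 1) n) {1..n}"
proof (rule inj_onI)
  fix i j assume *: "i \<in> {1..n}" "j \<in> {1..n}" "mod1 (i + 1) n = mod1 (j + 1) n"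
  then have "[i = j] (mod n)"
    by (simp add: mod1_eq_iff cong_add_rcancel_nat[of i 1 j, simplified])
  then have "mod1 i n = mod1 j n"
    using * by (simp add: mod1_eq_iff)
  with * show "i = j"
    by (simp add: mod1_id)
qed

text \<open>Iterating the successor from any element of \<open>B\<close> runs through the whole
  cycle. This supplies the acyclicity needed for the deletion induction: no nonempty subset of a
  proper subset of \<open>{1..n}\<close> is closed under the successor.\<close>

lemma mod1_Suc_closed_eq:
  assumes "n > 0" "B \<subseteq> {1..n}" "B \<noteq> {}" "\<And>k. k \<in> B \<Longrightarrow> mod1 (k + 1) n \<in> B"
  shows "B = {1..n}"
proof -
  obtain b where b: "b \<in> B"
    using assms by blast
  have "mod1 (b + i) n \<in> B" for i
  proof (induction i)
    case 0
    have "mod1 b n = b"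
      using b assms(2) by (intro mod1_id) blast
    then show ?case
      using b by simp
  next
    case (Suc i)
    then show ?case
      using assms(4)[OF Suc] mod1_Suc_mod1[OF assms(1)] by simp
  qed
  then have "(\<lambda>i. mod1 (b + i) n) ` {..<n} \<subseteq> B"
    by blast
  then show ?thesis
    using bij_betw_mod1_add[OF assms(1), of b] assms(2) by (auto simp: bij_betw_def)
qed

section \<open>Permutations as lists of positions\<close>

lemma adjacent_iff_nth:
  "(\<exists>us vs. xs = us @ a # b # vs) \<longleftrightarrow> (\<exists>i. Suc i < length xs \<and> xs ! i = a \<and> xs ! Suc i = b)"
proof
  assume "\<exists>us vs. xs = us @ a # b # vs"
  then obtain us vs where "xs = us @ a # b # vs"
    by blast
  then show "\<exists>i. Suc i < length xs \<and> xs ! i = a \<and> xs ! Suc i = b"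
    by (intro exI[of _ "length us"]) (auto simp: nth_append)
next
  assume "\<exists>i. Suc i < length xs \<and> xs ! i = a \<and> xs ! Suc i = b"
  then obtain i where i: "Suc i < length xs" "xs ! i = a" "xs ! Suc i = b"
    by blast
  then have "xs = take i xs @ a # b # drop (Suc (Suc i)) xs"
    by (metis Cons_nth_drop_Suc Suc_lessD append_take_drop_id)
  then show "\<exists>us vs. xs = us @ a # b # vs"
    by blast
qed

text \<open>Listing the positions in the cyclic order of their values, starting from the position \<open>z\<close> of
  the value \<open>c\<close>, turns \<open>k \<in> succession_set n \<pi>\<close> into adjacency of \<open>k\<close> and its successor. The choice
  of \<open>z\<close> ensures that no adjacency is needed between the last and the first entry.\<close>

lemma card_permutes_succession_fixed:
  assumes n: "n > 0" and A: "A \<subseteq> {1..n}" and z: "z \<in> {1..n}" "z \<notin> (\<lambda>k. mod1 (k + 1) n) ` A"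
    and c: "c \<in> {1..n}"
  shows "card {\<pi>. \<pi> permutes {1..n} \<and> A \<subseteq> succession_set n \<pi> \<and> \<pi> z = c} =
    card {xs \<in> permutations_of_set {1..n}. hd xs = z \<and>
      (\<forall>k\<in>A. \<exists>us vs. xs = us @ k # mod1 (k + 1) n # vs)}"
    (is "card ?P = card ?L")
proof -
  define r where "r = (\<lambda>i. mod1 (c + i) n)"
  define \<Phi> where "\<Phi> = (\<lambda>\<pi> :: nat \<Rightarrow> nat. map (\<lambda>i. inv \<pi> (r i)) [0..<n])"
  have r: "bij_betw r {..<n} {1..n}"
    unfolding r_def by (rule bij_betw_mod1_add[OF n])
  have r0: "r 0 = c"
    using c by (simp add: r_def mod1_id)
  have rn: "r n = c"
    using c n mod1_eq_iff[OF n, of "c + n" c] by (simp add: r_def mod1_id cong_def)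
  have rSuc: "r (Suc i) = mod1 (r i + 1) n" for i
    using mod1_Suc_mod1[OF n, of "c + i"] by (simp add: r_def)
  have "bij_betw \<Phi> ?P ?L"
    unfolding bij_betw_def
  proof (intro conjI equalityI subsetI)
    show "inj_on \<Phi> ?P"
    proof (rule inj_onI)
      fix \<pi> \<sigma> assume *: "\<pi> \<in> ?P" "\<sigma> \<in> ?P" "\<Phi> \<pi> = \<Phi> \<sigma>"
      have "inv \<pi> x = inv \<sigma> x" for x
      proof (cases "x \<in> {1..n}")
        case True
        then obtain i where "i < n" "x = r i"
          using bij_betw_imp_surj_on[OF r] by blast
        then show ?thesis
          using *(3) by (auto simp: \<Phi>_def)
      next
        case False
        then show ?thesis
          using * permutes_inv permutes_not_in by (metis (mono_tags, lifting) mem_Collect_eq)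
      qed
      then have "inv \<pi> = inv \<sigma>"
        by blast
      with * show "\<pi> = \<sigma>"
        by (metis (mono_tags, lifting) mem_Collect_eq permutes_inv_inv)
    qed
  next
    fix xs assume "xs \<in> \<Phi> ` ?P"
    then obtain \<pi> where \<pi>: "\<pi> permutes {1..n}" "A \<subseteq> succession_set n \<pi>" "\<pi> z = c"
      and xs: "xs = \<Phi> \<pi>"
      by blast
    have bij: "bij_betw (inv \<pi> \<circ> r) {..<n} {1..n}"
      using r permutes_inv[OF \<pi>(1)] permutes_imp_bij bij_betw_trans by blast
    have "set xs = {1..n}"
      using bij by (auto simp: xs \<Phi>_def bij_betw_def atLeast0LessThan)
    moreover have "distinct xs"
      using bij by (auto simp: xs \<Phi>_def bij_betw_def distinct_map atLeast0LessThan comp_def)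
    moreover have "hd xs = z"
      using n r0 \<pi> by (simp add: xs \<Phi>_def hd_map) (metis permutes_inverses(2))
    moreover have "\<exists>us vs. xs = us @ k # mod1 (k + 1) n # vs" if k: "k \<in> A" for k
    proof -
      have "\<pi> k \<in> {1..n}"
        using k A \<pi>(1) by (meson permutes_in_image subsetD)
      then obtain i where i: "i < n" "\<pi> k = r i"
        using bij_betw_imp_surj_on[OF r] by blast
      have *: "\<pi> (mod1 (k + 1) n) = r (Suc i)"
        using k \<pi>(2) i rSuc by (auto simp: succession_set_def)
      \<comment> \<open>At the last index, the successor of \<open>k\<close> would carry the value
        \<open>r n = c\<close> and hence be \<open>z\<close>, which is no successor of an element of
        \<open>A\<close>.\<close>
      have "Suc i \<noteq> n"
      proof
        assume "Suc i = n"
        with * rn \<pi> have "mod1 (k + 1) n = z"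
          by (metis permutes_inverses(2))
        with z k show False
          by blast
      qed
      with i * show ?thesis
        unfolding adjacent_iff_nth
        by (intro exI[of _ i]) (auto simp: xs \<Phi>_def permutes_inv_eq[OF \<pi>(1)] simp flip: i(2) *)
    qed
    ultimately show "xs \<in> ?L"
      by (auto intro: permutations_of_setI)
  next
    fix xs assume xs: "xs \<in> ?L"
    then have set: "set xs = {1..n}" "distinct xs" "hd xs = z"
      by (auto dest: permutations_of_setD)
    have len: "length xs = n"
      using distinct_card[OF set(2)] set by simp
    have bij: "bij_betw ((!) xs) {..<n} {1..n}"
      using bij_betw_nth[OF set(2)] set len by blast
    \<comment> \<open>The preimage of \<open>xs\<close> under \<open>\<Phi>\<close>: the entry at
      index \<open>i\<close> receives the value \<open>r i\<close>. The identity outside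
      \<open>{1..n}\<close> is what \<open>permutes\<close> demands.\<close>
    define p where "p = (\<lambda>x. if x \<in> {1..n} then r (inv_into {..<n} ((!) xs) x) else x)"
    have p_nth: "p (xs ! i) = r i" if "i < n" for i
    proof -
      have "xs ! i \<in> {1..n}"
        using that len set nth_mem by blast
      then show ?thesis
        using that bij by (simp add: p_def bij_betw_def inv_into_f_f)
    qed
    have "bij_betw (r \<circ> inv_into {..<n} ((!) xs)) {1..n} {1..n}"
      using r bij bij_betw_inv_into bij_betw_trans by blast
    then have "bij_betw p {1..n} {1..n}"
      by (rule iffD1[OF bij_betw_cong, rotated]) (simp add: p_def)
    then have p: "p permutes {1..n}"
      by (rule bij_imp_permutes) (auto simp: p_def)
    have "p z = c"
      using p_nth[of 0] n r0 set len by (simp add: hd_conv_nth flip: length_greater_0_conv)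
    moreover have "p (mod1 (k + 1) n) = mod1 (p k + 1) n" if "k \<in> A" for k
    proof -
      have "\<exists>us vs. xs = us @ k # mod1 (k + 1) n # vs"
        using xs that by blast
      then obtain i where i: "Suc i < length xs" "xs ! i = k" "xs ! Suc i = mod1 (k + 1) n"
        unfolding adjacent_iff_nth by blast
      then have "p k = r i" "p (mod1 (k + 1) n) = r (Suc i)"
        using p_nth[of i] p_nth[of "Suc i"] by (simp_all add: len)
      then show ?thesis
        using rSuc by simp
    qed
    then have "A \<subseteq> succession_set n p"
      using A by (auto simp: succession_set_def)
    moreover have "\<Phi> p = xs"
      using len p_nth by (intro nth_equalityI) (auto simp: \<Phi>_def permutes_inv_eq[OF p])
    ultimately show "xs \<in> \<Phi> ` ?P"
      using p by blast
  qed
  then show ?thesis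
    by (rule bij_betw_same_card)
qed

section \<open>Permutations whose succession set contains a given set\<close>

lemma finite_permutes_Collect: "finite S \<Longrightarrow> finite {\<pi>. \<pi> permutes S \<and> P \<pi>}"
  using finite_permutations[of S] by (rule rev_finite_subset) auto

text \<open>The permutations are classified by their value \<open>c\<close> at a position
  \<open>z\<close> that is not the successor of an element of \<open>A\<close>. Each of the
  \<open>n\<close> classes corresponds to the lists counted by deletion, so all have the same
  size.\<close>

lemma card_permutes_succession_proper:
  assumes n: "n > 0" and A: "A \<subset> {1..n}"
  shows "card {\<pi>. \<pi> permutes {1..n} \<and> A \<subseteq> succession_set n \<pi>} = n * fact (n - card A - 1)"
proof -
  let ?s = "\<lambda>k. mod1 (k + 1) n"
  have inj: "inj_on ?s A"
    using inj_on_mod1_Suc A by (meson inj_on_subset psubset_imp_subset)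
  have sub: "?s ` A \<subseteq> {1..n}"
    using mod1_in[OF n] by blast
  \<comment> \<open>The image of \<open>A\<close> is as small as the proper subset \<open>A\<close>,
    so it misses some position \<open>z\<close>.\<close>
  have "card (?s ` A) < card {1..n}"
    using inj A by (simp add: card_image psubset_card_mono del: card_atLeastAtMost)
  then obtain z where z: "z \<in> {1..n}" "z \<notin> ?s ` A"
    using sub by (metis order_less_irrefl subsetI subset_antisym)
  define P where "P = (\<lambda>c. {\<pi>. \<pi> permutes {1..n} \<and> A \<subseteq> succession_set n \<pi> \<and> \<pi> z = c})"
  have fin: "finite (P c)" for c
    unfolding P_def by (rule finite_permutes_Collect) simp
  have "{\<pi>. \<pi> permutes {1..n} \<and> A \<subseteq> succession_set n \<pi>} = (\<Union>c\<in>{1..n}. P c)"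
    using z(1) permutes_in_image[of _ "{1..n}" z] by (fastforce simp: P_def)
  also have "card \<dots> = (\<Sum>c\<in>{1..n}. card (P c))"
    using fin by (intro card_UN_disjoint) (auto simp: P_def)
  also have "\<dots> = (\<Sum>c\<in>{1..n}. fact (n - card A - 1))"
  proof (rule sum.cong[OF refl])
    fix c assume c: "c \<in> {1..n}"
    have "card (P c) = fact (card {1..n} - card A - 1)"
      unfolding P_def card_permutes_succession_fixed[OF n psubset_imp_subset[OF A] z c]
    proof (rule card_permutations_of_set_adjacent)
      show "\<exists>k\<in>B. ?s k \<notin> B" if "B \<subseteq> A" "B \<noteq> {}" for B
        using that A mod1_Suc_closed_eq[OF n, of B] by blast
    qed (use A sub inj z in auto)
    then show "card (P c) = fact (n - card A - 1)"
      by simp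
  qed
  finally show ?thesis
    by simp
qed

text \<open>For \<open>A = {1..n}\<close> the truncated subtraction gives \<open>fact 0 = 1\<close>, which is the correct value: the
  permutations are the \<open>n\<close> rotations.\<close>

lemma card_permutes_succession:
  assumes n: "n > 0" and A: "A \<subseteq> {1..n}"
  shows "card {\<pi>. \<pi> permutes {1..n} \<and> A \<subseteq> succession_set n \<pi>} = n * fact (n - card A - 1)"
proof (cases "A = {1..n}")
  case False
  with A show ?thesis
    by (intro card_permutes_succession_proper[OF n]) auto
next
  case True
  let ?s = "\<lambda>k. mod1 (k + 1) n"
  \<comment> \<open>All successions but one force the last one, which reduces the full set to the
    proper subset \<open>{1..n} - {n}\<close>.\<close>
  have "{1..n} \<subseteq> succession_set n \<pi>"
    if \<pi>: "\<pi> permutes {1..n}" and sub: "{1..n} - {n} \<subseteq> succession_set n \<pi>" for \<pi>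
  proof -
    have "?s ` {1..n} \<subseteq> {1..n}"
      using mod1_in[OF n] by blast
    then have s: "bij_betw ?s {1..n} {1..n}"
      using inj_on_mod1_Suc[of n] endo_inj_surj[of "{1..n}" ?s] by (simp add: bij_betw_def)
    have p: "bij_betw \<pi> {1..n} {1..n}"
      using \<pi> by (rule permutes_imp_bij)
    have agree: "\<pi> (?s k) = ?s (\<pi> k)" if "k \<in> {1..n} - {n}" for k
      using that sub by (auto simp: succession_set_def)
    \<comment> \<open>Both composites are bijections of \<open>{1..n}\<close>, so their values have
      the same sum; agreeing away from \<open>n\<close>, they agree at \<open>n\<close> as
      well.\<close>
    have "bij_betw (\<lambda>k. \<pi> (?s k)) {1..n} {1..n}" "bij_betw (\<lambda>k. ?s (\<pi> k)) {1..n} {1..n}"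
      using bij_betw_trans[OF s p] bij_betw_trans[OF p s] by (simp_all add: comp_def)
    moreover have "(\<Sum>k\<in>{1..n} - {n}. \<pi> (?s k)) = (\<Sum>k\<in>{1..n} - {n}. ?s (\<pi> k))"
      using agree by (rule sum.cong[OF refl])
    ultimately have "\<pi> (?s n) = ?s (\<pi> n)"
      using n sum.reindex_bij_betw[of "\<lambda>k. \<pi> (?s k)" "{1..n}" "{1..n}" "\<lambda>x. x"]
        sum.reindex_bij_betw[of "\<lambda>k. ?s (\<pi> k)" "{1..n}" "{1..n}" "\<lambda>x. x"]
        sum.remove[of "{1..n}" n "\<lambda>k. \<pi> (?s k)"] sum.remove[of "{1..n}" n "\<lambda>k. ?s (\<pi> k)"]
      by simp
    then show ?thesis
      using sub n by (auto simp: succession_set_def)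
  qed
  then have "{\<pi>. \<pi> permutes {1..n} \<and> A \<subseteq> succession_set n \<pi>} =
      {\<pi>. \<pi> permutes {1..n} \<and> {1..n} - {n} \<subseteq> succession_set n \<pi>}"
    unfolding True by blast
  also have "card \<dots> = n * fact (n - card ({1..n} - {n}) - 1)"
  proof (rule card_permutes_succession_proper[OF n])
    have "n \<in> {1..n}"
      using n by simp
    then show "{1..n} - {n} \<subset> {1..n}"
      by blast
  qed
  finally show ?thesis
    using n True by simp
qed

section \<open>Inclusion-exclusion for the exact succession set\<close>

lemma succession_set_subset: "succession_set n \<pi> \<subseteq> {1..n}"
  by (auto simp: succession_set_def)

lemma sum_Pow_card:
  fixes f :: "nat \<Rightarrow> 'a::semiring_1"
  assumes "finite S"
  shows "(\<Sum>T\<in>Pow S. f (card T)) = (\<Sum>j\<le>card S. of_nat (card S choose j) * f j)"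
proof -
  have "(\<Sum>T\<in>Pow S. f (card T)) = (\<Sum>j\<le>card S. of_nat (card {T \<in> Pow S. card T = j}) * f j)"
    using assms by (intro sum_fun_comp) (auto intro: card_mono)
  then show ?thesis
    using n_subsets[OF assms] by simp
qed

text \<open>For \<open>0 < n\<close> and \<open>m \<le> n\<close>, the inclusion-exclusion count of
  the permutations whose succession set is a given \<open>m\<close>-element set; \<open>h\<close> is
  the number of elements added to it in a superset. At \<open>h = n - m\<close> truncated
  subtraction gives \<open>fact 0 = 1\<close>, and \<open>n\<close> counts the rotations.\<close>

definition succession_count :: "nat \<Rightarrow> nat \<Rightarrow> real" where
  "succession_count n m =
    (\<Sum>h\<le>n - m. (-1) ^ h * real ((n - m) choose h) * (real n * fact (n - m - h - 1)))"

text \<open>Moebius inversion over complements: supersets of \<open>A\<close> become subsets of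
  \<open>S\<close>, and \<open>sum F (Pow T)\<close> counts the permutations whose succession set
  contains the complement of \<open>T\<close>, a number known from
  \<open>card_permutes_succession\<close>.\<close>

lemma card_permutes_succession_eq:
  assumes n: "n > 0" and A: "A \<subseteq> {1..n}"
  shows "real (card {\<pi>. \<pi> permutes {1..n} \<and> succession_set n \<pi> = A}) = succession_count n (card A)"
proof -
  define S where "S = {1..n} - A"
  define F where "F = (\<lambda>T. if T \<subseteq> {1..n}
    then real (card {\<pi>. \<pi> permutes {1..n} \<and> succession_set n \<pi> = {1..n} - T}) else 0)"
  have G: "sum F (Pow T) = real n * fact (card T - 1)" if T: "T \<subseteq> {1..n}" for T
  proof -
    have fin: "finite T"
      using T finite_subset by blast
    have "{\<pi>. \<pi> permutes {1..n} \<and> {1..n} - T \<subseteq> succession_set n \<pi>} =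
        (\<Union>R\<in>Pow T. {\<pi>. \<pi> permutes {1..n} \<and> succession_set n \<pi> = {1..n} - R})"
      (is "?P = (\<Union>R\<in>Pow T. ?Q R)")
    proof (intro equalityI subsetI)
      fix \<pi> assume "\<pi> \<in> ?P"
      then show "\<pi> \<in> (\<Union>R\<in>Pow T. ?Q R)"
        using succession_set_subset[of n \<pi>]
        by (intro UN_I[of "{1..n} - succession_set n \<pi>"]) auto
    qed auto
    also have "card \<dots> = (\<Sum>R\<in>Pow T. card (?Q R))"
    proof (rule card_UN_disjoint)
      show "\<forall>R\<in>Pow T. \<forall>R'\<in>Pow T. R \<noteq> R' \<longrightarrow> ?Q R \<inter> ?Q R' = {}"
        using T by (auto 0 0) blast+
    qed (use fin in \<open>auto intro!: finite_permutes_Collect simp del: One_nat_def\<close>)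
    also have "real \<dots> = sum F (Pow T)"
      using T by (auto simp: F_def intro!: sum.cong)
    finally have "sum F (Pow T) = real (card ?P)" ..
    also have "\<dots> = real n * fact (n - card ({1..n} - T) - 1)"
      by (subst card_permutes_succession[OF n]) auto
    also have "n - card ({1..n} - T) = card T"
      using T card_mono[OF _ T] by (simp add: card_Diff_subset[OF fin T] del: One_nat_def)
    finally show ?thesis .
  qed
  have S: "S \<subseteq> {1..n}" "finite S" "card S = n - card A"
    using A by (auto simp: S_def card_Diff_subset finite_subset)
  have "real (card {\<pi>. \<pi> permutes {1..n} \<and> succession_set n \<pi> = A}) = F S"
    using A by (simp add: F_def S_def double_diff)
  also have "F S = (\<Sum>T\<in>Pow S. (-1) ^ (card S - card T) * sum F (Pow T))"
    by (rule inclusion_exclusion_mobius[OF refl S(2)])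
  also have "\<dots> = (\<Sum>T\<in>Pow S. (-1) ^ (card S - card T) * (real n * fact (card T - 1)))"
    using S by (intro sum.cong refl) (auto simp: G subset_trans)
  also have "\<dots> = (\<Sum>j\<le>card S. real (card S choose j) *
      ((-1) ^ (card S - j) * (real n * fact (j - 1))))"
    by (rule sum_Pow_card[OF S(2)])
  \<comment> \<open>The substitution \<open>h = card S - j\<close> passes from the size of
    \<open>T\<close> to the number of elements that its complement in \<open>{1..n}\<close> adds to
    \<open>A\<close>.\<close>
  also have "\<dots> = succession_count n (card A)"
    unfolding succession_count_def S(3)[symmetric]
    by (rule sum.reindex_bij_witness[where i = "\<lambda>h. card S - h" and j = "\<lambda>h. card S - h"])
       (auto simp: binomial_symmetric[symmetric])
  finally show ?thesis .
qed

text \<open>Put \<open>d = n - m\<close>. For \<open>h < d\<close>, the product of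
  \<open>d choose h\<close> and \<open>fact (d - h - 1)\<close> is
  \<open>fact d / (fact h * (d - h))\<close>; the factor \<open>fact d\<close> cancels because
  \<open>n choose m\<close> is \<open>fact n / (fact m * fact d)\<close>. The summand
  \<open>h = d\<close> becomes the separate last term.\<close>

lemma succession_count_eq:
  assumes "m \<le> n"
  shows "real (n choose m) * (succession_count n m / fact n) = 1 / fact m *
    ((\<Sum>h<n - m. (-1) ^ h * (1 / fact h) * (real n / real (n - m - h)))
      + (-1) ^ (n - m) * (1 / fact (n - m)) * real n)"
proof -
  define d where "d = n - m"
  define X where "X =
    (\<Sum>h<d. (-1) ^ h * (1 / fact h) * (real n / real (d - h))) + (-1) ^ d * (1 / fact d) * real n"
  have "succession_count n m =
      (\<Sum>h<d. (-1) ^ h * real (d choose h) * (real n * fact (d - h - 1))) + (-1) ^ d * real n"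
    unfolding succession_count_def d_def[symmetric] by (simp flip: lessThan_Suc_atMost)
  also have "(\<Sum>h<d. (-1) ^ h * real (d choose h) * (real n * fact (d - h - 1))) =
      (\<Sum>h<d. fact d * ((-1) ^ h * (1 / fact h) * (real n / real (d - h))))"
  proof (rule sum.cong[OF refl])
    fix h assume h: "h \<in> {..<d}"
    then have "(fact (d - h) :: real) = real (d - h) * fact (d - h - 1)"
      by (simp add: fact_reduce)
    with h show "(-1) ^ h * real (d choose h) * (real n * fact (d - h - 1)) =
        fact d * ((-1) ^ h * (1 / fact h) * (real n / real (d - h)))"
      by (simp add: binomial_fact)
  qed
  finally have "succession_count n m = fact d * X"
    by (simp add: X_def sum_distrib_left distrib_left)
  moreover have "real (n choose m) = fact n / (fact m * fact d)"
    using assms by (simp add: binomial_fact d_def)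
  ultimately have "real (n choose m) * (succession_count n m / fact n) = 1 / fact m * X"
    by simp
  then show ?thesis
    unfolding X_def d_def .
qed

section \<open>The law of the random set and its exchangeability\<close>

lemma pmf_random_U:
  assumes "n > 0"
  shows "pmf (random_U n) A = (if A \<subseteq> {1..n} then succession_count n (card A) / fact n else 0)"
proof -
  let ?P = "{\<pi>. \<pi> permutes {1..n}}"
  have "id permutes {1..n}"
    by (rule permutes_id)
  then have P: "finite ?P" "?P \<noteq> {}" "card ?P = fact n"
    using finite_permutations[of "{1..n}"] card_permutations[of "{1..n}" n] by (blast, blast, simp)
  have "pmf (random_U n) A = real (card (?P \<inter> succession_set n -` {A})) / fact n"
    using P by (simp add: random_U_def random_perm_def pmf_map measure_pmf_of_set)
  also have "?P \<inter> succession_set n -` {A} = {\<pi>. \<pi> permutes {1..n} \<and> succession_set n \<pi> = A}"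
    by auto
  finally have pmf: "pmf (random_U n) A = real (card \<dots>) / fact n" .
  show ?thesis
  proof (cases "A \<subseteq> {1..n}")
    case True
    then show ?thesis
      using pmf card_permutes_succession_eq[OF assms True] by simp
  next
    case False
    then have "{\<pi>. \<pi> permutes {1..n} \<and> succession_set n \<pi> = A} = {}"
      using succession_set_subset by blast
    then show ?thesis
      unfolding pmf using False by (simp only: card.empty) simp
  qed
qed

text \<open>The \<open>n choose m\<close> subsets of size \<open>m\<close> share the mass
  \<open>w m\<close>; conditioning divides it by their total, which leaves the uniform mass.\<close>

lemma exchangeableI:
  assumes pmf: "\<And>A. pmf p A = (if A \<subseteq> {1..n} then w (card A) else 0)"
  shows "exchangeable n p"
    and "measure_pmf.prob p {A. card A = m} = real (n choose m) * w m"
proof -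
  let ?C = "\<lambda>m. {A. A \<subseteq> {1..n} \<and> card A = m}"
  have supp: "set_pmf p \<subseteq> Pow {1..n}"
  proof
    fix A assume "A \<in> set_pmf p"
    then have "pmf p A \<noteq> 0"
      by (simp add: set_pmf_iff)
    then show "A \<in> Pow {1..n}"
      using pmf[of A] by (cases "A \<subseteq> {1..n}") auto
  qed
  have card: "card (?C m) = n choose m" and fin: "finite (?C m)" for m
    using n_subsets[of "{1..n}" m] by auto
  have prob: "measure_pmf.prob p {A. card A = m} = real (n choose m) * w m" for m
  proof -
    have "measure_pmf.prob p {A. card A = m} = measure_pmf.prob p (?C m)"
      using supp by (intro measure_prob_cong_0) (auto simp: pmf)
    also have "\<dots> = (\<Sum>A\<in>?C m. w m)"
      using fin by (subst measure_measure_pmf_finite) (auto simp: pmf intro!: sum.cong)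
    finally show ?thesis
      by (simp only: sum_constant card)
  qed
  then show "measure_pmf.prob p {A. card A = m} = real (n choose m) * w m" .
  have "cond_pmf p {A. card A = m} = pmf_of_set (?C m)"
    if pos: "measure_pmf.prob p {A. card A = m} > 0" for m
  proof (rule pmf_eqI)
    fix A
    \<comment> \<open>Positive probability makes the event meet the support, as
      \<open>pmf_cond\<close> requires.\<close>
    have ne: "set_pmf p \<inter> {A. card A = m} \<noteq> {}"
      using pos by (metis measure_Int_set_pmf measure_empty less_irrefl inf_commute)
    \<comment> \<open>The first factor makes \<open>?C m\<close> nonempty, so that
      \<open>pmf_of_set\<close> is uniform on it; the second lets \<open>w m\<close> cancel in the
      quotient.\<close>
    have "real (n choose m) * w m \<noteq> 0"
      using pos unfolding prob by linarith
    then have "n choose m \<noteq> 0" "w m \<noteq> 0"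
      by (auto simp only: mult_eq_0_iff of_nat_eq_0_iff)
    moreover from this have "?C m \<noteq> {}"
      using card[of m] by (metis card.empty)
    ultimately show "pmf (cond_pmf p {A. card A = m}) A = pmf (pmf_of_set (?C m)) A"
      using fin[of m] by (simp add: pmf_cond[OF ne] pmf_of_set prob card pmf indicator_def
          del: One_nat_def)
  qed
  with supp show "exchangeable n p"
    by (simp add: exchangeable_def)
qed

theorem proposition5p1:
  fixes n :: nat
  assumes "n > 0"
  shows "exchangeable n (random_U n) \<and>
    (\<forall>m\<le>n. measure_pmf.prob (random_U n) {A. card A = m} =
      1 / fact m *
        ((\<Sum>h<n - m. (-1) ^ h * (1 / fact h) * (real n / real (n - m - h)))
          + (-1) ^ (n - m) * (1 / fact (n - m)) * real n))"
proof (intro conjI allI impI)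
  note law = exchangeableI[where w = "\<lambda>m. succession_count n m / fact n", OF pmf_random_U[OF assms]]
  show "exchangeable n (random_U n)"
    by (rule law(1))
  show "measure_pmf.prob (random_U n) {A. card A = m} =
      1 / fact m *
        ((\<Sum>h<n - m. (-1) ^ h * (1 / fact h) * (real n / real (n - m - h)))
          + (-1) ^ (n - m) * (1 / fact (n - m)) * real n)" if "m \<le> n" for m
    using law(2) succession_count_eq[OF that] by (rule trans)
qed

end
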